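(* Fix constants $\delta,\alpha\in(0,1/2)$, $L>0$, and let $\varphi:[-1,1]\to[0,\infty)$ be a given $L$-Lipschitz convex surrogate. Define $$\kappa=4\sqrt{2}\,L\sqrt{\log\left(\frac{2M}{\delta}\right)}.$$ Let $f$ be a deterministic real-valued convex function. Let $\tilde\lambda$ be any solution of $$\min_{\lambda\in\Lambda}f(\lambda)\quad\text{s.t.}\quad\sum_{i=1}^n\varphi(F(\lambda,\xi_i))\le n\alpha-\kappa\sqrt n,$$ and let $f_\varphi^*$ be the value of the objective at the optimum in $$\min_{\lambda\in\Lambda}f(\lambda)\quad\text{s.t.}\quad\mathbb{E}[\varphi(F(\lambda,\xi))]\le\alpha.$$ Then the following hold with probability at least $1-2\delta$: (i) $\tilde\lambda$ is feasible for the chance constrained problem $\min_{\lambda\in\Lambda}f(\lambda)$ s.t. $\mathbb{P}\{F(\lambda,\xi)\le0\}\ge1-\alpha$; that is, $\tilde\lambda\in\Lambda$ and $\mathbb{P}\{F(\lambda,\xi)\le0\}\big|_{\lambda=\tilde\lambda}\ge1-\alpha$, where the probability is over $\xi$ only. (ii) If there exists $\varepsilon\in(0,1)$ such that the constraint $\mathbb{E}[\varphi(F(\lambda,\xi))]\le\varepsilon\alpha$ is feasible for some $\lambda\in\Lambda$, then for $$n\ge\left(\frac{4\kappa}{(1-\varepsilon)\alpha}\right)^2$$ we have $$f(\tilde\lambda)-f_\varphi^*\le\frac{4\varphi(1)\kappa}{(1-\varepsilon)\alpha\sqrt n}.$$ In particular, as $M$ and $n$ go to infinity with all other quantities kept fixed,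 we obtain $$f(\tilde\lambda)-f_\varphi^*=\mathcal{O}\left(\sqrt{\frac{\log M}{n}}\right).$$
   Context: A convex surrogate is a function $\varphi:[-1,1]\to[0,\infty)$ that is non-decreasing, continuous and convex with $\varphi(0)=1$. $\Lambda=\{\lambda\in\mathbb{R}^M:\lambda_j\ge0,\ \sum_{j=1}^M\lambda_j=1\}$ is the flat simplex of $\mathbb{R}^M$. $\xi$ is a random vector with values in a set $\Xi$, $g_1,\dots,g_M$ are arbitrary functions on $\Xi$ taking values in $[-1,1]$, $F(\lambda,\xi)=\sum_{j=1}^M\lambda_jg_j(\xi)$, and $\xi_1,\dots,\xi_n$ are independent copies of $\xi$.
   Formalization: The bound in (ii) is false for arbitrary convex f (scale f up), so it is proved assuming f varies by at most 2φ(1) on Λ; the O-claim is proved with the variation of f on Λ bounded by any fixed B, with the constant depending on B. *)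

theory Defs
  imports "HOL-Probability.Probability"
begin

definition convex_surrogate :: "(real \<Rightarrow> real) \<Rightarrow> bool" where
  "convex_surrogate \<phi> \<longleftrightarrow>
     (\<forall>x\<in>{-1..1}. 0 \<le> \<phi> x) \<and> mono_on {-1..1} \<phi> \<and> continuous_on {-1..1} \<phi> \<and>
     convex_on {-1..1} \<phi> \<and> \<phi> 0 = 1"

text \<open>
  The number M of base functions tends to infinity in the theorem, so it cannot be a type.
  A vector of \<open>\<real>\<^sup>M\<close> is a function on \<open>nat\<close> that vanishes outside \<open>{..<M}\<close>; coordinates and
  sample points are numbered from 0.
\<close>

definition flat_simplex :: "nat \<Rightarrow> (nat \<Rightarrow> real) set" where
  "flat_simplex M =
     {l. (\<forall>j<M. 0 \<le> l j) \<and> (\<forall>j\<ge>M. l j = 0) \<and> (\<Sum>j<M. l j) = 1}"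

text \<open>
  The type \<open>nat \<Rightarrow> real\<close> is not in the class \<open>real_vector\<close>, so \<open>convex_on\<close> is unfolded here.
  Convexity is only required on the simplex, where the objective is used.
\<close>

definition convex_on_simplex :: "nat \<Rightarrow> ((nat \<Rightarrow> real) \<Rightarrow> real) \<Rightarrow> bool" where
  "convex_on_simplex M f \<longleftrightarrow>
     (\<forall>x\<in>flat_simplex M. \<forall>y\<in>flat_simplex M. \<forall>t\<in>{0..1}.
        f (\<lambda>j. (1 - t) * x j + t * y j) \<le> (1 - t) * f x + t * f y)"

text \<open>
  The error bound of the theorem does not change when the objective is multiplied by a positive
  constant, while the suboptimality gap does; it therefore needs control on the range of the
  objective. Oscillation at most \<open>2 * \<phi> 1\<close>, which holds for instance when \<open>\<bar>f\<bar> \<le> \<phi> 1\<close>, is what the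
  factor \<open>4 * \<phi> 1\<close> of the bound pays for.
\<close>

definition oscillation_le :: "nat \<Rightarrow> ((nat \<Rightarrow> real) \<Rightarrow> real) \<Rightarrow> real \<Rightarrow> bool" where
  "oscillation_le M f B \<longleftrightarrow> (\<forall>x\<in>flat_simplex M. \<forall>y\<in>flat_simplex M. f x - f y \<le> B)"

definition aggregate :: "nat \<Rightarrow> (nat \<Rightarrow> 'x \<Rightarrow> real) \<Rightarrow> (nat \<Rightarrow> real) \<Rightarrow> 'x \<Rightarrow> real" where
  "aggregate M g l x = (\<Sum>j<M. l j * g j x)"

text \<open>
  The set of values of the random vector \<open>\<xi>\<close> is \<open>space X\<close>, and \<open>\<xi>s i\<close> for \<open>i < n\<close> are the
  independent copies. Measurability of the \<open>g j\<close> is what gives the expectation and the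
  probability over \<open>\<xi>\<close> their meaning.
\<close>

locale chance_sample = prob_space P
  for P :: "'a measure" +
  fixes X :: "'x measure" and \<xi> :: "'a \<Rightarrow> 'x" and \<xi>s :: "nat \<Rightarrow> 'a \<Rightarrow> 'x"
    and g :: "nat \<Rightarrow> 'x \<Rightarrow> real" and M n :: nat
  assumes M_pos: "1 \<le> M" and n_pos: "1 \<le> n"
    and xi_measurable: "\<xi> \<in> measurable P X"
    and copies_indep: "indep_vars (\<lambda>_. X) \<xi>s {..<n}"
    and copies_distr: "\<And>i. i < n \<Longrightarrow> distr P X (\<xi>s i) = distr P X \<xi>"
    and g_measurable: "\<And>j. j < M \<Longrightarrow> g j \<in> borel_measurable X"
    and g_range: "\<And>j x. j < M \<Longrightarrow> x \<in> space X \<Longrightarrow> g j x \<in> {-1..1}"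

definition kappa :: "real \<Rightarrow> nat \<Rightarrow> real \<Rightarrow> real" where
  "kappa L M \<delta> = 4 * sqrt 2 * L * sqrt (ln (2 * real M / \<delta>))"

text \<open>\<open>x i\<close> for \<open>i < n\<close> are the observed sample values.\<close>

definition sample_solution ::
  "((nat \<Rightarrow> real) \<Rightarrow> real) \<Rightarrow> (real \<Rightarrow> real) \<Rightarrow> real \<Rightarrow> real \<Rightarrow> nat \<Rightarrow> (nat \<Rightarrow> 'x \<Rightarrow> real)
     \<Rightarrow> nat \<Rightarrow> (nat \<Rightarrow> 'x) \<Rightarrow> (nat \<Rightarrow> real) \<Rightarrow> bool" where
  "sample_solution f \<phi> \<alpha> \<kappa> M g n x lt \<longleftrightarrow>
     is_arg_min f
       (\<lambda>l. l \<in> flat_simplex M \<and>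
            (\<Sum>i<n. \<phi> (aggregate M g l (x i))) \<le> real n * \<alpha> - \<kappa> * sqrt (real n)) lt"

definition surrogate_feasible ::
  "(real \<Rightarrow> real) \<Rightarrow> real \<Rightarrow> nat \<Rightarrow> (nat \<Rightarrow> 'x \<Rightarrow> real) \<Rightarrow> 'a measure \<Rightarrow> ('a \<Rightarrow> 'x)
     \<Rightarrow> (nat \<Rightarrow> real) set" where
  "surrogate_feasible \<phi> \<alpha> M g P \<xi> =
     {l \<in> flat_simplex M. (\<integral>\<omega>. \<phi> (aggregate M g l (\<xi> \<omega>)) \<partial>P) \<le> \<alpha>}"

text \<open>
  An infimum, so that it also makes sense when the minimum is not attained (a convex function
  on the simplex may jump at the relative boundary).
\<close>

definition surrogate_value ::
  "((nat \<Rightarrow> real) \<Rightarrow> real) \<Rightarrow> (real \<Rightarrow> real) \<Rightarrow> real \<Rightarrow> nat \<Rightarrow> (nat \<Rightarrow> 'x \<Rightarrow> real)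
     \<Rightarrow> 'a measure \<Rightarrow> ('a \<Rightarrow> 'x) \<Rightarrow> real" where
  "surrogate_value f \<phi> \<alpha> M g P \<xi> = (INF l\<in>surrogate_feasible \<phi> \<alpha> M g P \<xi>. f l)"

definition chance_feasible ::
  "real \<Rightarrow> nat \<Rightarrow> (nat \<Rightarrow> 'x \<Rightarrow> real) \<Rightarrow> 'a measure \<Rightarrow> ('a \<Rightarrow> 'x) \<Rightarrow> (nat \<Rightarrow> real) set" where
  "chance_feasible \<alpha> M g P \<xi> =
     {l \<in> flat_simplex M. 1 - \<alpha> \<le> measure P {\<omega> \<in> space P. aggregate M g l (\<xi> \<omega>) \<le> 0}}"

end

theory Submission
  imports Defs
begin

text \<open>
  Everything rests on one uniform deviation bound: with probability at least \<open>1 - \<delta>\<close>, empirical and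
  true surrogate risk (summed over the sample) differ by at most \<open>\<kappa> * sqrt n\<close> on the whole simplex.
  To prove it, bound the exponential moment of the maximal deviation over a finite net of the simplex
  by treating the sample points one at a time: convexity symmetrises a single term, a two-point
  contraction replaces the Lipschitz loss by the linear function \<open>aggregate M g l\<close>, and a linear
  function on the simplex is maximal at a vertex, which costs only a factor \<open>M\<close>.  Markov's inequality
  then uses half of \<open>\<kappa> * sqrt n\<close>; the other half pays for the net.

  Given the deviation bound, a sample-feasible point has true risk at most \<open>\<alpha>\<close>, hence satisfies the
  chance constraint since \<open>\<phi>\<close> dominates the indicator of the positive numbers.  For the objective,
  move a competitor towards the strictly feasible point by the fraction
  \<open>2 * \<kappa> / ((1 - \<epsilon>) * \<alpha> * sqrt n)\<close>: the mixture is sample-feasible, and by convexity its objective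
  has grown by at most this fraction of the oscillation.
\<close>

subsection \<open>Contraction for exponentials of maxima\<close>

text \<open>The increment is \<open>exp b * (exp d - 1)\<close>, a product of nonnegative increasing
  factors. Together with monotonicity this is all that the two-point contraction uses about
  \<open>exp\<close>.\<close>

lemma exp_increment_mono:
  fixes b b' d d' :: real
  assumes "b \<le> b'" "0 \<le> d" "d \<le> d'"
  shows "exp (b + d) - exp b \<le> exp (b' + d') - exp b'"
proof -
  have "exp b * (exp d - 1) \<le> exp b' * (exp d' - 1)"
    using assms by (intro mult_mono) auto
  then show ?thesis by (simp add: exp_add algebra_simps)
qed

text \<open>\<open>cosh\<close> is the moment generating function of a fair random sign, so for
  nonnegative arguments this is the inequality behind Hoeffding's lemma with success probability 1/2
  and interval length \<open>2 * y\<close>; evenness covers the rest.\<close>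

lemma cosh_le_exp_square: "cosh (x :: real) \<le> exp (x\<^sup>2 / 2)"
proof -
  have *: "cosh y \<le> exp (y\<^sup>2 / 2)" if "0 \<le> y" for y :: real
  proof -
    have pos: "0 < 1 + 1/2 * (exp (2 * y) - 1)"
      using that by (simp add: add_pos_nonneg)
    have "- y + ln (1 + 1/2 * (exp (2 * y) - 1)) \<le> y\<^sup>2 / 2"
      using Hoeffdings_lemma_aux[of "2 * y" "1/2"] that by (simp add: power_mult_distrib)
    then have "exp (- y + ln (1 + 1/2 * (exp (2 * y) - 1))) \<le> exp (y\<^sup>2 / 2)"
      by simp
    also have "exp (- y + ln (1 + 1/2 * (exp (2 * y) - 1))) = cosh y"
      using pos by (simp only: exp_add exp_ln) (simp add: cosh_def exp_minus field_simps flip: exp_add exp_double)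
    finally show ?thesis .
  qed
  show ?thesis
    using *[of "\<bar>x\<bar>"] by (cases "0 \<le> x") auto
qed

lemma exp_mult_cosh: "exp y * cosh z = (exp (y + z) + exp (y - z)) / (2 :: real)"
  by (simp add: cosh_def distrib_left mult_exp_exp)

text \<open>The unprimed and primed data belong to a maximiser of \<open>a + v\<close> and one of
  \<open>a - v\<close>; the last two hypotheses are their optimality. If \<open>u\<close> and
  \<open>u'\<close> have opposite signs, one sign pattern dominates term by term. Otherwise the
  point with the larger \<open>\<bar>u\<bar>\<close> receives the favourable sign, and its gain
  outweighs the loss at the other point; hence the \<open>max\<close> over the two patterns.\<close>

lemma exp_contraction_pair:
  fixes a u v a' u' v' :: real
  assumes "\<bar>v\<bar> \<le> \<bar>u\<bar>" "\<bar>v'\<bar> \<le> \<bar>u'\<bar>" "\<bar>v - v'\<bar> \<le> \<bar>u - u'\<bar>"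
    and "a' + v' \<le> a + v" "a - v \<le> a' - v'"
  shows "exp (a + v) + exp (a' - v') \<le> max (exp (a + u) + exp (a' - u')) (exp (a' + u') + exp (a - u))"
proof -
  \<comment> \<open>Negating both \<open>u\<close> and \<open>u'\<close> swaps the two arguments of
    \<open>max\<close>, so the first of them may be taken nonnegative.\<close>
  have *: "exp (a + v) + exp (a' - v') \<le> max (exp (a + w) + exp (a' - w')) (exp (a' + w') + exp (a - w))"
    if "0 \<le> w" "\<bar>v\<bar> \<le> \<bar>w\<bar>" "\<bar>v'\<bar> \<le> \<bar>w'\<bar>" "\<bar>v - v'\<bar> \<le> \<bar>w - w'\<bar>" for w w'
  proof (cases "w' \<le> 0")
    case True
    then have "exp (a + v) \<le> exp (a + w)" "exp (a' - v') \<le> exp (a' - w')" using that by auto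
    then show ?thesis by linarith
  next
    case False
    show ?thesis
    proof (cases "w' \<le> w")
      case True
      \<comment> \<open>Optimality gives \<open>a' - w' \<le> a' + v' \<le> a + v\<close>, and the
        bound on the differences gives \<open>w' - v' \<le> w - v\<close>: the gain starts higher
        and is at least as long as the loss.\<close>
      have "exp (a' - w' + (w' - v')) - exp (a' - w') \<le> exp (a + v + (w - v)) - exp (a + v)"
        using that assms(4,5) False True by (intro exp_increment_mono) auto
      then show ?thesis by simp
    next
      case F2: False
      \<comment> \<open>Now the primed point gains: \<open>a - w \<le> a - v \<le> a' - v'\<close>
        and \<open>w + v \<le> w' + v'\<close>, which leads to the flipped sign pattern.\<close>
      have "exp (a - w + (w + v)) - exp (a - w) \<le> exp (a' - v' + (w' + v')) - exp (a' - v')"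
        using that assms(4,5) False F2 by (intro exp_increment_mono) auto
      then show ?thesis by simp
    qed
  qed
  show ?thesis
  proof (cases "0 \<le> u")
    case True
    then show ?thesis using *[of u u'] assms by simp
  next
    case False
    then show ?thesis using *[of "- u" "- u'"] assms by (simp add: max.commute add.commute abs_minus_commute)
  qed
qed

text \<open>The contraction principle for a single random sign, without the factor 1/2 of the
  average. The two maxima on the left are attained at some \<open>l\<close> and \<open>m\<close>;
  the pair inequality at these points produces only values that the maxima on the right
  dominate.\<close>

lemma Max_exp_contraction:
  fixes a u v :: "'l \<Rightarrow> real"
  assumes fin: "finite T" "T \<noteq> {}"
    and v: "\<And>l. l \<in> T \<Longrightarrow> \<bar>v l\<bar> \<le> \<bar>u l\<bar>"
    and diff: "\<And>l m. l \<in> T \<Longrightarrow> m \<in> T \<Longrightarrow> \<bar>v l - v m\<bar> \<le> \<bar>u l - u m\<bar>"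
  shows "(MAX l\<in>T. exp (a l + v l)) + (MAX l\<in>T. exp (a l - v l))
    \<le> (MAX l\<in>T. exp (a l + u l)) + (MAX l\<in>T. exp (a l - u l))"
proof -
  have attained: "\<exists>k\<in>T. Max (h ` T) = h k" for h :: "'l \<Rightarrow> real"
  proof -
    have "Max (h ` T) \<in> h ` T" using fin by (intro Max_in) auto
    then show ?thesis by blast
  qed
  have upper: "h k \<le> Max (h ` T)" if "k \<in> T" for h :: "'l \<Rightarrow> real" and k
    using that fin by simp
  obtain l where l: "l \<in> T" "(MAX l\<in>T. exp (a l + v l)) = exp (a l + v l)" using attained by blast
  obtain m where m: "m \<in> T" "(MAX l\<in>T. exp (a l - v l)) = exp (a m - v m)" using attained by blast
  have "exp (a m + v m) \<le> exp (a l + v l)" "exp (a l - v l) \<le> exp (a m - v m)"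
    using upper[OF m(1), of "\<lambda>l. exp (a l + v l)"] upper[OF l(1), of "\<lambda>l. exp (a l - v l)"] l m by auto
  then have "exp (a l + v l) + exp (a m - v m)
      \<le> max (exp (a l + u l) + exp (a m - u m)) (exp (a m + u m) + exp (a l - u l))"
    using v[OF l(1)] v[OF m(1)] diff[OF l(1) m(1)] by (intro exp_contraction_pair) auto
  also have "\<dots> \<le> (MAX l\<in>T. exp (a l + u l)) + (MAX l\<in>T. exp (a l - u l))"
    using l(1) m(1) upper[of _ "\<lambda>l. exp (a l + u l)"] upper[of _ "\<lambda>l. exp (a l - u l)"]
    by (intro max.boundedI add_mono) auto
  finally show ?thesis using l m by simp
qed

section \<open>Linear functions on the simplex\<close>

lemma aggregate_bound:
  assumes "l \<in> flat_simplex M" "\<And>j. j < M \<Longrightarrow> \<bar>g j x\<bar> \<le> 1"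
  shows "\<bar>aggregate M g l x\<bar> \<le> 1"
proof -
  have "\<bar>aggregate M g l x\<bar> \<le> (\<Sum>j<M. \<bar>l j * g j x\<bar>)"
    unfolding aggregate_def by (rule sum_abs)
  also have "\<dots> \<le> (\<Sum>j<M. l j)"
    using assms by (intro sum_mono) (auto simp: abs_mult flat_simplex_def mult_left_le)
  finally show ?thesis using assms(1) by (simp add: flat_simplex_def)
qed

lemma flat_simplex_component:
  assumes "l \<in> flat_simplex M"
  shows "0 \<le> l j" "l j \<le> 1"
proof -
  show "0 \<le> l j"
    using assms by (cases "j < M") (auto simp: flat_simplex_def)
  show "l j \<le> 1"
  proof (cases "j < M")
    case True
    then have "l j \<le> (\<Sum>j<M. l j)"
      using assms by (intro member_le_sum) (auto simp: flat_simplex_def)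
    then show ?thesis using assms by (simp add: flat_simplex_def)
  qed (use assms in \<open>auto simp: flat_simplex_def\<close>)
qed

text \<open>Jensen's inequality with weights \<open>l j\<close>, which are then bounded by 1. This
  makes the cost of the maximum depend on the number \<open>M\<close> of vertices and not on the
  size of the net.\<close>

lemma exp_convex_combination_le:
  assumes "l \<in> flat_simplex M"
  shows "exp (\<Sum>j<M. l j * b j) \<le> (\<Sum>j<M. exp (b j :: real))"
proof -
  have "{..<M} \<noteq> {}" using assms by (auto simp: flat_simplex_def)
  then have "exp (\<Sum>j<M. l j * b j) \<le> (\<Sum>j<M. l j * exp (b j))"
    using convex_on_sum[of "{..<M}" UNIV exp l b] assms exp_convex
    by (auto simp: flat_simplex_def)
  also have "\<dots> \<le> (\<Sum>j<M. exp (b j))"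
    using flat_simplex_component[OF assms] by (intro sum_mono) simp
  finally show ?thesis .
qed

section \<open>Exponential moments of the maximal deviation over a finite set of weights\<close>

text \<open>Finiteness of \<open>T\<close> keeps the maxima measurable. The loss
  \<open>\<psi> l\<close> stands for the surrogate loss shifted so that it vanishes where the
  aggregate does, the normalisation that the contraction asks for.\<close>

locale lipschitz_losses = prob_space D
  for D :: "'x measure" +
  fixes T :: "(nat \<Rightarrow> real) set" and M :: nat and g :: "nat \<Rightarrow> 'x \<Rightarrow> real"
    and \<psi> :: "(nat \<Rightarrow> real) \<Rightarrow> 'x \<Rightarrow> real" and L :: real
  assumes finite_T: "finite T" and T_nonempty: "T \<noteq> {}" and T_subset: "T \<subseteq> flat_simplex M"
    and L_nonneg: "0 \<le> L"
    and g_meas: "\<And>j. j < M \<Longrightarrow> g j \<in> borel_measurable D"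
    and g_bound: "\<And>j x. j < M \<Longrightarrow> x \<in> space D \<Longrightarrow> \<bar>g j x\<bar> \<le> 1"
    and loss_meas: "\<And>l. l \<in> T \<Longrightarrow> \<psi> l \<in> borel_measurable D"
    and loss_abs: "\<And>l x. l \<in> T \<Longrightarrow> x \<in> space D \<Longrightarrow> \<bar>\<psi> l x\<bar> \<le> L * \<bar>aggregate M g l x\<bar>"
    and loss_diff: "\<And>l m x. l \<in> T \<Longrightarrow> m \<in> T \<Longrightarrow> x \<in> space D \<Longrightarrow>
      \<bar>\<psi> l x - \<psi> m x\<bar> \<le> L * \<bar>aggregate M g l x - aggregate M g m x\<bar>"
begin

lemma loss_bound: "l \<in> T \<Longrightarrow> x \<in> space D \<Longrightarrow> \<bar>\<psi> l x\<bar> \<le> L"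
  using loss_abs[of l x] aggregate_bound[of l M g x] T_subset g_bound[of _ x]
    mult_left_mono[OF _ L_nonneg, of "\<bar>aggregate M g l x\<bar>" 1] by force

lemma integrable_loss: "l \<in> T \<Longrightarrow> integrable D (\<psi> l)"
  using loss_bound loss_meas by (intro integrable_const_bound[where B = L]) auto

lemma integrable_exp_loss:
  assumes "l \<in> T"
  shows "integrable D (\<lambda>x. exp (c + r * \<psi> l x))"
proof (intro integrable_const_bound[where B = "exp (\<bar>c\<bar> + \<bar>r\<bar> * L)"] AE_I2)
  fix x assume "x \<in> space D"
  then have "\<bar>r * \<psi> l x\<bar> \<le> \<bar>r\<bar> * L"
    using loss_bound[OF assms] by (auto simp: abs_mult intro: mult_left_mono)
  then show "norm (exp (c + r * \<psi> l x)) \<le> exp (\<bar>c\<bar> + \<bar>r\<bar> * L)" by auto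
qed (use loss_meas[OF assms] in measurable)

lemma integrable_Max_exp_loss: "integrable D (\<lambda>x. MAX l\<in>T. exp (a l + r * \<psi> l x))"
  using integrable_exp_loss finite_T T_nonempty by (intro integrable_MAX) auto

text \<open>
  Instead of introducing a ghost sample, the exponent is split as the mean of
  \<open>a l + 2 * s * expectation (\<psi> l)\<close> and \<open>a l - 2 * s * \<psi> l x\<close>; Jensen's inequality in one
  variable then removes the expectation from the first half.
\<close>

lemma Max_exp_symmetrization:
  "(\<integral>x. (MAX l\<in>T. exp (a l + s * (expectation (\<psi> l) - \<psi> l x))) \<partial>D)
    \<le> (\<integral>x. ((MAX l\<in>T. exp (a l + 2 * s * \<psi> l x)) + (MAX l\<in>T. exp (a l - 2 * s * \<psi> l x))) / 2 \<partial>D)"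
proof -
  let ?W = "\<integral>x. (MAX l\<in>T. exp (a l + 2 * s * \<psi> l x)) \<partial>D"
  let ?V = "\<lambda>x. MAX l\<in>T. exp (a l - 2 * s * \<psi> l x)"
  have int_W: "integrable D (\<lambda>x. MAX l\<in>T. exp (a l + 2 * s * \<psi> l x))"
    by (rule integrable_Max_exp_loss)
  have int_V: "integrable D ?V"
    using integrable_Max_exp_loss[of a "- 2 * s"] by simp
  have jensen: "exp (a l + 2 * s * expectation (\<psi> l)) \<le> ?W" if l: "l \<in> T" for l
  proof -
    have "exp (expectation (\<lambda>x. a l + 2 * s * \<psi> l x)) \<le> expectation (\<lambda>x. exp (a l + 2 * s * \<psi> l x))"
      using integrable_loss[OF l] integrable_exp_loss[OF l]
      by (intro jensens_inequality[where I = UNIV]) (auto intro: exp_convex)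
    also have "\<dots> \<le> ?W"
      using l finite_T by (intro integral_mono integrable_exp_loss int_W) auto
    finally show ?thesis using integrable_loss[OF l] by (simp add: prob_space)
  qed
  have pointwise: "(MAX l\<in>T. exp (a l + s * (expectation (\<psi> l) - \<psi> l x))) \<le> (?W + ?V x) / 2" for x
  proof (intro Max.boundedI)
    fix y assume "y \<in> (\<lambda>l. exp (a l + s * (expectation (\<psi> l) - \<psi> l x))) ` T"
    then obtain l where l: "l \<in> T" and y: "y = exp (a l + s * (expectation (\<psi> l) - \<psi> l x))" by auto
    have mean: "(1 - 1/2) *\<^sub>R (a l + 2 * s * expectation (\<psi> l)) + (1/2) *\<^sub>R (a l - 2 * s * \<psi> l x)
        = a l + s * (expectation (\<psi> l) - \<psi> l x)"
      by (simp add: field_simps)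
    have "exp ((1 - 1/2) *\<^sub>R (a l + 2 * s * expectation (\<psi> l)) + (1/2) *\<^sub>R (a l - 2 * s * \<psi> l x))
        \<le> (1 - 1/2) * exp (a l + 2 * s * expectation (\<psi> l)) + (1/2) * exp (a l - 2 * s * \<psi> l x)"
      by (intro convex_onD[OF exp_convex]) auto
    then have "y \<le> (exp (a l + 2 * s * expectation (\<psi> l)) + exp (a l - 2 * s * \<psi> l x)) / 2"
      unfolding y mean by argo
    moreover have "exp (a l - 2 * s * \<psi> l x) \<le> ?V x"
      using l finite_T by auto
    ultimately show "y \<le> (?W + ?V x) / 2" using jensen[OF l] by argo
  qed (use finite_T T_nonempty in auto)
  have "integrable D (\<lambda>x. MAX l\<in>T. exp (a l + s * (expectation (\<psi> l) - \<psi> l x)))"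
    using integrable_Max_exp_loss[of "\<lambda>l. a l + s * expectation (\<psi> l)" "- s"]
    by (simp add: algebra_simps)
  then have "(\<integral>x. (MAX l\<in>T. exp (a l + s * (expectation (\<psi> l) - \<psi> l x))) \<partial>D) \<le> (\<integral>x. (?W + ?V x) / 2 \<partial>D)"
    using int_V pointwise by (intro integral_mono) auto
  also have "\<dots> = (\<integral>x. ((MAX l\<in>T. exp (a l + 2 * s * \<psi> l x)) + ?V x) / 2 \<partial>D)"
    using int_V int_W by (simp add: prob_space)
  finally show ?thesis .
qed

lemma Max_exp_nonneg: "0 \<le> (MAX l\<in>T. exp (h l :: real))"
proof -
  obtain k where "k \<in> T" using T_nonempty by auto
  then have "exp (h k) \<le> (MAX l\<in>T. exp (h l))" using finite_T by (intro Max_ge) auto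
  then show ?thesis using exp_ge_zero[of "h k"] by linarith
qed

text \<open>Symmetrisation, followed by the contraction applied at each \<open>x\<close>. The
  statement uses nonnegative integrals so that the iterated integrals of the later induction can be
  exchanged on measurability alone.\<close>

lemma Max_exp_linearization:
  "(\<integral>\<^sup>+x. ennreal (MAX l\<in>T. exp (a l + s * (expectation (\<psi> l) - \<psi> l x))) \<partial>D)
    \<le> (\<integral>\<^sup>+x. ennreal (((MAX l\<in>T. exp (a l + 2 * s * L * aggregate M g l x)) +
          (MAX l\<in>T. exp (a l - 2 * s * L * aggregate M g l x))) / 2) \<partial>D)"
proof -
  have int: "integrable D (\<lambda>x. MAX l\<in>T. exp (a l + s * (expectation (\<psi> l) - \<psi> l x)))"
    using integrable_Max_exp_loss[of "\<lambda>l. a l + s * expectation (\<psi> l)" "- s"]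
    by (simp add: algebra_simps)
  have int_plus: "integrable D (\<lambda>x. MAX l\<in>T. exp (a l + 2 * s * \<psi> l x))"
    by (rule integrable_Max_exp_loss)
  have int_minus: "integrable D (\<lambda>x. MAX l\<in>T. exp (a l - 2 * s * \<psi> l x))"
    using integrable_Max_exp_loss[of a "- 2 * s"] by simp
  have "(\<integral>\<^sup>+x. ennreal (MAX l\<in>T. exp (a l + s * (expectation (\<psi> l) - \<psi> l x))) \<partial>D)
      = ennreal (\<integral>x. (MAX l\<in>T. exp (a l + s * (expectation (\<psi> l) - \<psi> l x))) \<partial>D)"
    using int Max_exp_nonneg by (intro nn_integral_eq_integral AE_I2) auto
  also have "\<dots> \<le> ennreal (\<integral>x. ((MAX l\<in>T. exp (a l + 2 * s * \<psi> l x)) + (MAX l\<in>T. exp (a l - 2 * s * \<psi> l x))) / 2 \<partial>D)"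
    by (rule ennreal_leI[OF Max_exp_symmetrization])
  also have "\<dots> = (\<integral>\<^sup>+x. ennreal (((MAX l\<in>T. exp (a l + 2 * s * \<psi> l x)) + (MAX l\<in>T. exp (a l - 2 * s * \<psi> l x))) / 2) \<partial>D)"
    using int_plus int_minus
    by (intro nn_integral_eq_integral[symmetric] AE_I2 divide_nonneg_pos add_nonneg_nonneg Max_exp_nonneg
        integrable_divide_zero Bochner_Integration.integrable_add) auto
  also have "\<dots> \<le> (\<integral>\<^sup>+x. ennreal (((MAX l\<in>T. exp (a l + 2 * s * L * aggregate M g l x)) +
          (MAX l\<in>T. exp (a l - 2 * s * L * aggregate M g l x))) / 2) \<partial>D)"
  proof (intro nn_integral_mono ennreal_leI divide_right_mono Max_exp_contraction finite_T T_nonempty)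
    fix x l assume x: "x \<in> space D" and l: "l \<in> T"
    have "\<bar>2 * s * \<psi> l x\<bar> \<le> \<bar>2 * s\<bar> * (L * \<bar>aggregate M g l x\<bar>)"
      unfolding abs_mult[of "2 * s"] using loss_abs[OF l x] by (rule mult_left_mono) simp
    also have "\<dots> = \<bar>2 * s * L * aggregate M g l x\<bar>"
      using L_nonneg by (simp add: abs_mult)
    finally show "\<bar>2 * s * \<psi> l x\<bar> \<le> \<bar>2 * s * L * aggregate M g l x\<bar>" .
    fix m assume m: "m \<in> T"
    have "\<bar>2 * s * (\<psi> l x - \<psi> m x)\<bar> \<le> \<bar>2 * s\<bar> * (L * \<bar>aggregate M g l x - aggregate M g m x\<bar>)"
      unfolding abs_mult[of "2 * s"] using loss_diff[OF l m x] by (rule mult_left_mono) simp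
    also have "\<dots> = \<bar>2 * s * L * (aggregate M g l x - aggregate M g m x)\<bar>"
      using L_nonneg by (simp add: abs_mult)
    finally show "\<bar>2 * s * \<psi> l x - 2 * s * \<psi> m x\<bar> \<le> \<bar>2 * s * L * aggregate M g l x - 2 * s * L * aggregate M g m x\<bar>"
      by (simp only: right_diff_distrib)
  qed simp
  finally show ?thesis .
qed

lemma measurable_coordinate:
  "i \<in> I \<Longrightarrow> h \<in> borel_measurable D \<Longrightarrow> (\<lambda>x. h (x i)) \<in> borel_measurable (Pi\<^sub>M I (\<lambda>_. D))"
  by (rule measurable_compose[OF measurable_component_singleton])

text \<open>
  The linear term \<open>b\<close> carries the coordinates that have already been linearised; this makes the
  induction on the sample size go through.
\<close>

lemma Max_exp_deviation_le:
  "(\<integral>\<^sup>+x. ennreal (MAX l\<in>T. exp ((\<Sum>j<M. l j * b j) + s * (\<Sum>i<n. expectation (\<psi> l) - \<psi> l (x i))))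
      \<partial>Pi\<^sub>M {..<n} (\<lambda>_. D))
    \<le> ennreal (exp (real n * (2 * s * L)\<^sup>2 / 2) * (\<Sum>j<M. exp (b j)))"
proof (induction n arbitrary: b)
  case 0
  interpret PiM0: prob_space "Pi\<^sub>M {} (\<lambda>_::nat. D)"
    by (intro prob_space_PiM prob_space_axioms)
  \<comment> \<open>With no sample point left, only the linear term remains and the vertex bound
    finishes.\<close>
  have "(MAX l\<in>T. exp (\<Sum>j<M. l j * b j)) \<le> (\<Sum>j<M. exp (b j))"
    using finite_T T_nonempty T_subset by (intro Max.boundedI) (auto intro!: exp_convex_combination_le)
  then show ?case by (simp add: PiM0.emeasure_space_1 ennreal_leI)
next
  case (Suc n)
  define c where "c = 2 * s * L"
  interpret product_sigma_finite "\<lambda>_::nat. D"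
    by standard
  \<comment> \<open>\<open>F\<close> is the integrand for \<open>Suc n\<close> points. Linearising
    its last coordinate leaves \<open>H\<close>, the average of two integrands \<open>G\<close> of
    the induction hypothesis whose linear terms are shifted by plus and minus
    \<open>c * g j (x n)\<close>.\<close>
  define F where "F x = (MAX l\<in>T. exp ((\<Sum>j<M. l j * b j) + s * (\<Sum>i<Suc n. expectation (\<psi> l) - \<psi> l (x i))))" for x
  define G where "G b x = (MAX l\<in>T. exp ((\<Sum>j<M. l j * b j) + s * (\<Sum>i<n. expectation (\<psi> l) - \<psi> l (x i))))"
    for b and x :: "nat \<Rightarrow> 'x"
  define H where "H x = (G (\<lambda>j. b j + c * g j (x n)) x + G (\<lambda>j. b j - c * g j (x n)) x) / 2" for x
  have [measurable]: "F \<in> borel_measurable (Pi\<^sub>M (insert n {..<n}) (\<lambda>_. D))"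
    unfolding F_def
    by (intro borel_measurable_Max finite_T borel_measurable_exp borel_measurable_add borel_measurable_times
        borel_measurable_sum borel_measurable_diff borel_measurable_const measurable_compose[OF _ borel_measurable_exp]
        measurable_coordinate loss_meas) auto
  have [measurable]: "H \<in> borel_measurable (Pi\<^sub>M (insert n {..<n}) (\<lambda>_. D))"
    unfolding H_def G_def
    by (intro borel_measurable_Max finite_T borel_measurable_add borel_measurable_times borel_measurable_divide
        borel_measurable_sum borel_measurable_diff borel_measurable_const measurable_compose[OF _ borel_measurable_exp]
        measurable_coordinate loss_meas g_meas) auto
  have [measurable]: "G b' \<in> borel_measurable (Pi\<^sub>M {..<n} (\<lambda>_. D))" for b'
    unfolding G_def
    by (intro borel_measurable_Max finite_T borel_measurable_add borel_measurable_times
        borel_measurable_sum borel_measurable_diff borel_measurable_const measurable_compose[OF _ borel_measurable_exp]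
        measurable_coordinate loss_meas) auto
  have G_nonneg: "0 \<le> G b' x" for b' x
    unfolding G_def by (rule Max_exp_nonneg)
  have G_update: "G b' (x(n := y)) = G b' x" for b' x y
    unfolding G_def by (intro arg_cong[where f = Max] image_cong refl) (auto intro!: sum.cong)
  have half: "ennreal ((u + v) / 2) = ennreal (1/2) * (ennreal u + ennreal v)" if "0 \<le> u" "0 \<le> v" for u v
  proof -
    have "ennreal (1/2 * (u + v)) = ennreal (1/2) * ennreal (u + v)"
      using that by (intro ennreal_mult) auto
    then show ?thesis using that by simp
  qed
  have split: "(\<Sum>j<M. l j * (b j + r * g j y)) = (\<Sum>j<M. l j * b j) + r * aggregate M g l y" for l r y
    by (simp add: aggregate_def sum.distrib sum_distrib_left algebra_simps)
  have split_minus: "(\<Sum>j<M. l j * (b j - r * g j y)) = (\<Sum>j<M. l j * b j) - r * aggregate M g l y" for l r y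
    using split[of l "- r" y] by simp
  have "(\<integral>\<^sup>+x. ennreal (F x) \<partial>Pi\<^sub>M (insert n {..<n}) (\<lambda>_. D))
      = (\<integral>\<^sup>+x. (\<integral>\<^sup>+y. ennreal (F (x(n := y))) \<partial>D) \<partial>Pi\<^sub>M {..<n} (\<lambda>_. D))"
    by (intro product_nn_integral_insert) auto
  also have "\<dots> \<le> (\<integral>\<^sup>+x. (\<integral>\<^sup>+y. ennreal (H (x(n := y))) \<partial>D) \<partial>Pi\<^sub>M {..<n} (\<lambda>_. D))"
  proof (rule nn_integral_mono)
    fix x :: "nat \<Rightarrow> 'x"
    define a where "a l = (\<Sum>j<M. l j * b j) + s * (\<Sum>i<n. expectation (\<psi> l) - \<psi> l (x i))" for l
    have "F (x(n := y)) = (MAX l\<in>T. exp (a l + s * (expectation (\<psi> l) - \<psi> l y)))" for y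
      unfolding F_def a_def by (simp add: algebra_simps)
    moreover have "H (x(n := y)) = ((MAX l\<in>T. exp (a l + 2 * s * L * aggregate M g l y)) +
          (MAX l\<in>T. exp (a l - 2 * s * L * aggregate M g l y))) / 2" for y
    proof -
      have "(\<Sum>j<M. l j * (b j + c * g j y)) + s * (\<Sum>i<n. expectation (\<psi> l) - \<psi> l (x i))
          = a l + 2 * s * L * aggregate M g l y" for l
        unfolding split a_def c_def by argo
      moreover have "(\<Sum>j<M. l j * (b j - c * g j y)) + s * (\<Sum>i<n. expectation (\<psi> l) - \<psi> l (x i))
          = a l - 2 * s * L * aggregate M g l y" for l
        unfolding split_minus a_def c_def by argo
      ultimately show ?thesis
        unfolding H_def G_update by (simp only: G_def fun_upd_same)
    qed
    ultimately show "(\<integral>\<^sup>+y. ennreal (F (x(n := y))) \<partial>D) \<le> (\<integral>\<^sup>+y. ennreal (H (x(n := y))) \<partial>D)"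
      using Max_exp_linearization[of a s] by (simp only:)
  qed
  also have "\<dots> = (\<integral>\<^sup>+x. ennreal (H x) \<partial>Pi\<^sub>M (insert n {..<n}) (\<lambda>_. D))"
    by (intro product_nn_integral_insert[symmetric]) auto
  \<comment> \<open>The last point becomes the outer variable: once it is fixed, the shifts of
    \<open>b\<close> are constants and the induction hypothesis applies to both \<open>G\<close>
    terms.\<close>
  also have "\<dots> = (\<integral>\<^sup>+y. (\<integral>\<^sup>+x. ennreal (H (x(n := y))) \<partial>Pi\<^sub>M {..<n} (\<lambda>_. D)) \<partial>D)"
    by (intro product_nn_integral_insert_rev) auto
  also have "\<dots> \<le> (\<integral>\<^sup>+y. ennreal (exp (real (Suc n) * c\<^sup>2 / 2) * (\<Sum>j<M. exp (b j))) \<partial>D)"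
  proof (rule nn_integral_mono)
    fix y assume y: "y \<in> space D"
    let ?p = "\<lambda>j. b j + c * g j y" and ?m = "\<lambda>j. b j - c * g j y"
    have "(\<integral>\<^sup>+x. ennreal (H (x(n := y))) \<partial>Pi\<^sub>M {..<n} (\<lambda>_. D))
        = (\<integral>\<^sup>+x. ennreal (1/2) * (ennreal (G ?p x) + ennreal (G ?m x)) \<partial>Pi\<^sub>M {..<n} (\<lambda>_. D))"
      unfolding H_def G_update fun_upd_same
      by (intro nn_integral_cong half G_nonneg)
    also have "\<dots> = ennreal (1/2) * ((\<integral>\<^sup>+x. ennreal (G ?p x) \<partial>Pi\<^sub>M {..<n} (\<lambda>_. D)) + (\<integral>\<^sup>+x. ennreal (G ?m x) \<partial>Pi\<^sub>M {..<n} (\<lambda>_. D)))"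
      by (simp add: nn_integral_cmult nn_integral_add)
    also have "\<dots> \<le> ennreal (1/2) * (ennreal (exp (real n * c\<^sup>2 / 2) * (\<Sum>j<M. exp (?p j))) + ennreal (exp (real n * c\<^sup>2 / 2) * (\<Sum>j<M. exp (?m j))))"
      unfolding G_def c_def by (intro mult_left_mono add_mono Suc.IH) auto
    also have "\<dots> = ennreal ((exp (real n * c\<^sup>2 / 2) * (\<Sum>j<M. exp (?p j)) + exp (real n * c\<^sup>2 / 2) * (\<Sum>j<M. exp (?m j))) / 2)"
      by (intro half[symmetric] mult_nonneg_nonneg sum_nonneg exp_ge_zero)
    also have "(exp (real n * c\<^sup>2 / 2) * (\<Sum>j<M. exp (?p j)) + exp (real n * c\<^sup>2 / 2) * (\<Sum>j<M. exp (?m j))) / 2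
        = exp (real n * c\<^sup>2 / 2) * (\<Sum>j<M. exp (b j) * cosh (c * g j y))"
      unfolding exp_mult_cosh sum_divide_distrib[symmetric] sum.distrib by argo
    \<comment> \<open>The two opposite shifts have averaged to a \<open>cosh\<close>. As
      \<open>\<bar>g j y\<bar> \<le> 1\<close>, its bound \<open>exp (c\<^sup>2 / 2)\<close> no
      longer depends on \<open>y\<close> or \<open>j\<close> and supplies the factor for one more
      sample point.\<close>
    also have "ennreal \<dots> \<le> ennreal (exp (real n * c\<^sup>2 / 2) * (\<Sum>j<M. exp (b j) * exp (c\<^sup>2 / 2)))"
    proof (intro ennreal_leI mult_left_mono sum_mono)
      fix j assume j: "j \<in> {..<M}"
      have "(g j y)\<^sup>2 \<le> 1" using g_bound[of j y] j y by (simp add: abs_square_le_1)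
      then have "(c * g j y)\<^sup>2 \<le> c\<^sup>2" by (simp add: power_mult_distrib mult_left_le)
      then show "cosh (c * g j y) \<le> exp (c\<^sup>2 / 2)"
        using cosh_le_exp_square[of "c * g j y"] by (meson divide_right_mono exp_le_cancel_iff order_trans zero_le_numeral)
    qed auto
    also have "exp (real n * c\<^sup>2 / 2) * (\<Sum>j<M. exp (b j) * exp (c\<^sup>2 / 2)) = exp (real (Suc n) * c\<^sup>2 / 2) * (\<Sum>j<M. exp (b j))"
      by (simp add: sum_distrib_right[symmetric] add_divide_distrib distrib_right exp_add)
    finally show "(\<integral>\<^sup>+x. ennreal (H (x(n := y))) \<partial>Pi\<^sub>M {..<n} (\<lambda>_. D)) \<le> ennreal (exp (real (Suc n) * c\<^sup>2 / 2) * (\<Sum>j<M. exp (b j)))" .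
  qed
  also have "\<dots> = ennreal (exp (real (Suc n) * c\<^sup>2 / 2) * (\<Sum>j<M. exp (b j)))"
    by (simp add: emeasure_space_1)
  finally show ?case
    unfolding F_def c_def lessThan_Suc .
qed

text \<open>Markov's inequality for the exponential of the maximum, with \<open>b = 0\<close>, so
  that the sum over the vertices is \<open>M\<close>. The sign of \<open>s\<close> is free, so both
  tails follow from this bound.\<close>

lemma uniform_deviation_tail:
  "emeasure (Pi\<^sub>M {..<n} (\<lambda>_. D))
      {x \<in> space (Pi\<^sub>M {..<n} (\<lambda>_. D)). \<exists>l\<in>T. t \<le> s * (\<Sum>i<n. expectation (\<psi> l) - \<psi> l (x i))}
    \<le> ennreal (real M * exp (real n * (2 * s * L)\<^sup>2 / 2 - t))"
proof -
  let ?P = "Pi\<^sub>M {..<n} (\<lambda>_::nat. D)"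
  let ?S = "\<lambda>l x. s * (\<Sum>i<n. expectation (\<psi> l) - \<psi> l (x i))"
  define u where "u x = ennreal (MAX l\<in>T. exp (?S l x))" for x
  have [measurable]: "u \<in> borel_measurable ?P"
    unfolding u_def
    by (intro measurable_compose[OF _ measurable_ennreal] borel_measurable_Max finite_T borel_measurable_times
        borel_measurable_sum borel_measurable_diff borel_measurable_const measurable_compose[OF _ borel_measurable_exp]
        measurable_coordinate loss_meas) auto
  have "{x \<in> space ?P. \<exists>l\<in>T. t \<le> ?S l x} \<subseteq> {x \<in> space ?P. 1 \<le> ennreal (exp (- t)) * u x}"
  proof safe
    fix x l assume l: "l \<in> T" "t \<le> ?S l x"
    have "exp t \<le> exp (?S l x)" using l by simp
    also have "\<dots> \<le> (MAX l\<in>T. exp (?S l x))" using l(1) finite_T by (intro Max_ge) auto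
    finally have "exp (- t) * exp t \<le> exp (- t) * (MAX l\<in>T. exp (?S l x))" by simp
    then have "1 \<le> exp (- t) * (MAX l\<in>T. exp (?S l x))"
      by (simp only: exp_minus_inverse mult.commute[of "exp (- t)" "exp t"])
    then have "ennreal 1 \<le> ennreal (exp (- t) * (MAX l\<in>T. exp (?S l x)))"
      by (rule ennreal_leI)
    then show "1 \<le> ennreal (exp (- t)) * u x"
      by (simp only: u_def ennreal_1 ennreal_mult'[OF exp_ge_zero])
  qed
  then have "emeasure ?P {x \<in> space ?P. \<exists>l\<in>T. t \<le> ?S l x} \<le> emeasure ?P {x \<in> space ?P. 1 \<le> ennreal (exp (- t)) * u x}"
    by (intro emeasure_mono) auto
  also have "\<dots> \<le> ennreal (exp (- t)) * (\<integral>\<^sup>+x. u x * indicator (space ?P) x \<partial>?P)"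
    by (intro nn_integral_Markov_inequality) auto
  also have "\<dots> = ennreal (exp (- t)) * (\<integral>\<^sup>+x. u x \<partial>?P)"
    by (intro arg_cong[where f = "times (ennreal (exp (- t)))"] nn_integral_cong) auto
  also have "\<dots> \<le> ennreal (exp (- t)) * ennreal (exp (real n * (2 * s * L)\<^sup>2 / 2) * real M)"
    using Max_exp_deviation_le[where b = "\<lambda>_. 0" and s = s and n = n]
    by (intro mult_left_mono) (auto simp: u_def)
  also have "\<dots> = ennreal (exp (- t) * (exp (real n * (2 * s * L)\<^sup>2 / 2) * real M))"
    by (simp only: ennreal_mult'[OF exp_ge_zero])
  also have "exp (- t) * (exp (real n * (2 * s * L)\<^sup>2 / 2) * real M)
      = real M * exp (real n * (2 * s * L)\<^sup>2 / 2 - t)"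
    by (simp add: exp_diff exp_minus field_simps)
  finally show ?thesis .
qed

end

subsection \<open>Uniform deviation of the surrogate risk\<close>

lemma flat_simplex_nonempty:
  assumes "1 \<le> M"
  shows "flat_simplex M \<noteq> {}"
proof -
  have "(\<lambda>j. if j = 0 then 1 else 0) \<in> flat_simplex M"
    using assms by (auto simp: flat_simplex_def)
  then show ?thesis by blast
qed

lemma flat_simplex_mix:
  assumes "l \<in> flat_simplex M" "m \<in> flat_simplex M" "0 \<le> t" "t \<le> 1"
  shows "(\<lambda>j. (1 - t) * l j + t * m j) \<in> flat_simplex M"
  using assms by (auto simp: flat_simplex_def sum.distrib sum_distrib_left[symmetric])

text \<open>Rounding \<open>K * l j\<close> down sorts the simplex into finitely many classes,
  within which coordinates differ by at most \<open>1 / K\<close>. The net consists of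
  representatives of these classes and therefore lies in the simplex itself.\<close>

lemma flat_simplex_net:
  assumes "0 < \<eta>"
  obtains T where "finite T" "T \<subseteq> flat_simplex M"
    "\<And>l. l \<in> flat_simplex M \<Longrightarrow> \<exists>m\<in>T. (\<Sum>j<M. \<bar>l j - m j\<bar>) \<le> \<eta>"
proof -
  \<comment> \<open>The \<open>M\<close> coordinates together contribute at most
    \<open>M / K\<close>, which is below \<open>\<eta>\<close> for this \<open>K\<close>.\<close>
  obtain K :: nat where K: "real M / \<eta> < real K" using reals_Archimedean2 by blast
  then have "0 < K" using assms by (cases K) (auto simp: field_simps)
  define h where "h l = (\<lambda>j\<in>{..<M}. nat \<lfloor>real K * l j\<rfloor>)" for l :: "nat \<Rightarrow> real"
  have "h ` flat_simplex M \<subseteq> (\<Pi>\<^sub>E j\<in>{..<M}. {..K})"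
  proof (intro image_subsetI PiE_I)
    fix l j assume l: "l \<in> flat_simplex M" and j: "j \<in> {..<M}"
    have "real K * l j \<le> real K" using flat_simplex_component[OF l] by (simp add: mult_left_le)
    then have "\<lfloor>real K * l j\<rfloor> \<le> int K" by linarith
    then show "h l j \<in> {..K}" using j by (simp add: h_def)
  qed (simp add: h_def)
  then have fin: "finite (h ` flat_simplex M)"
    by (rule finite_subset) (auto intro: finite_PiE)
  obtain T where T: "T \<subseteq> flat_simplex M" "finite T" "h ` flat_simplex M = h ` T"
    using finite_subset_image[OF fin subset_refl] by blast
  show thesis
  proof (rule that[OF T(2,1)])
    fix l assume l: "l \<in> flat_simplex M"
    then obtain m where m: "m \<in> T" "h l = h m" using T(3) by blast
    then have m': "m \<in> flat_simplex M" using T(1) by blast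
    have "\<bar>l j - m j\<bar> \<le> 1 / real K" if "j < M" for j
    proof -
      have "nat \<lfloor>real K * l j\<rfloor> = nat \<lfloor>real K * m j\<rfloor>"
        using fun_cong[OF m(2), of j] that by (simp add: h_def)
      then have "\<lfloor>real K * l j\<rfloor> = \<lfloor>real K * m j\<rfloor>"
        using flat_simplex_component(1)[OF l, of j] flat_simplex_component(1)[OF m', of j]
        by (simp add: eq_nat_nat_iff)
      then have "\<bar>real K * l j - real K * m j\<bar> \<le> 1" by linarith
      then have "real K * \<bar>l j - m j\<bar> \<le> 1" by (simp add: abs_mult flip: right_diff_distrib)
      then show ?thesis using \<open>0 < K\<close> by (simp add: field_simps)
    qed
    then have "(\<Sum>j<M. \<bar>l j - m j\<bar>) \<le> (\<Sum>j<M. 1 / real K)" by (intro sum_mono) auto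
    also have "\<dots> \<le> \<eta>" using K \<open>0 < K\<close> assms by (simp add: field_simps)
    finally show "\<exists>m\<in>T. (\<Sum>j<M. \<bar>l j - m j\<bar>) \<le> \<eta>" using m(1) by blast
  qed
qed

lemma aggregate_diff_le:
  assumes "\<And>j. j < M \<Longrightarrow> \<bar>g j x\<bar> \<le> 1"
  shows "\<bar>aggregate M g l x - aggregate M g m x\<bar> \<le> (\<Sum>j<M. \<bar>l j - m j\<bar>)"
proof -
  have "\<bar>aggregate M g l x - aggregate M g m x\<bar> = \<bar>\<Sum>j<M. (l j - m j) * g j x\<bar>"
    by (simp add: aggregate_def left_diff_distrib sum_subtractf)
  also have "\<dots> \<le> (\<Sum>j<M. \<bar>(l j - m j) * g j x\<bar>)" by (rule sum_abs)
  also have "\<dots> \<le> (\<Sum>j<M. \<bar>l j - m j\<bar>)"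
    using assms by (intro sum_mono) (auto simp: abs_mult mult_left_le)
  finally show ?thesis .
qed

lemma aggregate_mix:
  "aggregate M g (\<lambda>j. (1 - t) * l j + t * m j) x = (1 - t) * aggregate M g l x + t * aggregate M g m x"
  by (simp add: aggregate_def sum.distrib sum_distrib_left distrib_right mult.assoc)

lemma kappa_pos:
  assumes "0 < L" "1 \<le> M" "0 < \<delta>" "\<delta> < 1"
  shows "0 < kappa L M \<delta>"
  using assms by (simp add: kappa_def)

section \<open>True and empirical surrogate risk, and the chance constraint\<close>

locale chance_surrogate = chance_sample P X \<xi> \<xi>s g M n
  for P :: "'a measure" and X :: "'x measure" and \<xi> \<xi>s g M n +
  fixes \<phi> :: "real \<Rightarrow> real" and L :: real
  assumes surrogate: "convex_surrogate \<phi>" and lipschitz: "L-lipschitz_on {-1..1} \<phi>"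
    and L_pos: "0 < L"
begin

definition risk :: "(nat \<Rightarrow> real) \<Rightarrow> real" where
  "risk l = (\<integral>\<omega>. \<phi> (aggregate M g l (\<xi> \<omega>)) \<partial>P)"

text \<open>A sum and not a mean, as in the constraint of the sample problem; its counterpart is
  \<open>real n * risk l\<close>.\<close>

definition empirical_risk :: "(nat \<Rightarrow> real) \<Rightarrow> 'a \<Rightarrow> real" where
  "empirical_risk l \<omega> = (\<Sum>i<n. \<phi> (aggregate M g l (\<xi>s i \<omega>)))"

lemma g_abs_le: "j < M \<Longrightarrow> x \<in> space X \<Longrightarrow> \<bar>g j x\<bar> \<le> 1"
  using g_range[of j x] by auto

lemma aggregate_range: "l \<in> flat_simplex M \<Longrightarrow> x \<in> space X \<Longrightarrow> aggregate M g l x \<in> {-1..1}"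
  using aggregate_bound[of l M g x] g_abs_le[of _ x] by (auto simp: abs_le_iff)

lemma phi_lipschitz: "a \<in> {-1..1} \<Longrightarrow> b \<in> {-1..1} \<Longrightarrow> \<bar>\<phi> a - \<phi> b\<bar> \<le> L * \<bar>a - b\<bar>"
  using lipschitz_onD[OF lipschitz, of a b] by (simp add: dist_real_def)

lemma phi_zero: "\<phi> 0 = 1" and phi_nonneg: "a \<in> {-1..1} \<Longrightarrow> 0 \<le> \<phi> a"
  and phi_mono: "a \<in> {-1..1} \<Longrightarrow> b \<in> {-1..1} \<Longrightarrow> a \<le> b \<Longrightarrow> \<phi> a \<le> \<phi> b"
  using surrogate by (auto simp: convex_surrogate_def mono_on_def)

lemma aggregate_measurable: "aggregate M g l \<in> borel_measurable X"
  unfolding aggregate_def using g_measurable by (intro borel_measurable_sum) auto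

text \<open>\<open>\<phi>\<close> is only constrained on \<open>{-1..1}\<close>, so measurability goes through the truncated argument.\<close>

lemma loss_measurable:
  assumes "l \<in> flat_simplex M"
  shows "(\<lambda>x. \<phi> (aggregate M g l x)) \<in> borel_measurable X"
proof -
  have "continuous_on UNIV (\<lambda>y. \<phi> (max (-1) (min 1 y)))"
  proof (rule continuous_on_compose2[of "{-1..1}" \<phi>])
    show "continuous_on {-1..1} \<phi>" using surrogate by (simp add: convex_surrogate_def)
  qed (auto intro!: continuous_intros)
  then have "(\<lambda>x. \<phi> (max (-1) (min 1 (aggregate M g l x)))) \<in> borel_measurable X"
    by (intro measurable_compose[OF aggregate_measurable] borel_measurable_continuous_onI)
  then show ?thesis
    using aggregate_range[OF assms] by (subst measurable_cong[where g = "\<lambda>x. \<phi> (max (-1) (min 1 (aggregate M g l x)))"]) auto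
qed

lemma xi_space: "\<omega> \<in> space P \<Longrightarrow> \<xi> \<omega> \<in> space X"
  using xi_measurable by (rule measurable_space)

lemma xis_measurable: "i < n \<Longrightarrow> \<xi>s i \<in> measurable P X"
  using copies_indep by (auto simp: indep_vars_def)

lemma xis_space: "i < n \<Longrightarrow> \<omega> \<in> space P \<Longrightarrow> \<xi>s i \<omega> \<in> space X"
  using xis_measurable by (rule measurable_space)

lemma integrable_loss:
  assumes "l \<in> flat_simplex M"
  shows "integrable P (\<lambda>\<omega>. \<phi> (aggregate M g l (\<xi> \<omega>)))"
proof (intro integrable_const_bound[where B = "\<phi> 1"] AE_I2)
  fix \<omega> assume "\<omega> \<in> space P"
  then show "norm (\<phi> (aggregate M g l (\<xi> \<omega>))) \<le> \<phi> 1"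
    using aggregate_range[OF assms xi_space, of \<omega>] phi_nonneg phi_mono[of _ 1] by auto
qed (rule measurable_compose[OF xi_measurable loss_measurable[OF assms]])

lemma loss_diff_le:
  assumes "l \<in> flat_simplex M" "m \<in> flat_simplex M" "x \<in> space X"
  shows "\<bar>\<phi> (aggregate M g l x) - \<phi> (aggregate M g m x)\<bar> \<le> L * (\<Sum>j<M. \<bar>l j - m j\<bar>)"
proof -
  have "\<bar>\<phi> (aggregate M g l x) - \<phi> (aggregate M g m x)\<bar> \<le> L * \<bar>aggregate M g l x - aggregate M g m x\<bar>"
    using assms by (intro phi_lipschitz aggregate_range)
  also have "\<dots> \<le> L * (\<Sum>j<M. \<bar>l j - m j\<bar>)"
    using assms(3) g_abs_le L_pos by (intro mult_left_mono aggregate_diff_le) auto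
  finally show ?thesis .
qed

lemma risk_diff_le:
  assumes "l \<in> flat_simplex M" "m \<in> flat_simplex M"
  shows "\<bar>risk l - risk m\<bar> \<le> L * (\<Sum>j<M. \<bar>l j - m j\<bar>)"
proof -
  have "\<bar>risk l - risk m\<bar> = \<bar>\<integral>\<omega>. \<phi> (aggregate M g l (\<xi> \<omega>)) - \<phi> (aggregate M g m (\<xi> \<omega>)) \<partial>P\<bar>"
    using assms integrable_loss by (simp add: risk_def)
  also have "\<dots> \<le> (\<integral>\<omega>. \<bar>\<phi> (aggregate M g l (\<xi> \<omega>)) - \<phi> (aggregate M g m (\<xi> \<omega>))\<bar> \<partial>P)"
    by (rule integral_abs_bound)
  also have "\<dots> \<le> (\<integral>\<omega>. L * (\<Sum>j<M. \<bar>l j - m j\<bar>) \<partial>P)"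
    using assms integrable_loss xi_space loss_diff_le by (intro integral_mono) auto
  finally show ?thesis by (simp add: prob_space)
qed

lemma empirical_risk_diff_le:
  assumes "l \<in> flat_simplex M" "m \<in> flat_simplex M" "\<omega> \<in> space P"
  shows "\<bar>empirical_risk l \<omega> - empirical_risk m \<omega>\<bar> \<le> real n * (L * (\<Sum>j<M. \<bar>l j - m j\<bar>))"
proof -
  have "\<bar>empirical_risk l \<omega> - empirical_risk m \<omega>\<bar>
      \<le> (\<Sum>i<n. \<bar>\<phi> (aggregate M g l (\<xi>s i \<omega>)) - \<phi> (aggregate M g m (\<xi>s i \<omega>))\<bar>)"
    unfolding empirical_risk_def sum_subtractf[symmetric] by (rule sum_abs)
  also have "\<dots> \<le> (\<Sum>i<n. L * (\<Sum>j<M. \<bar>l j - m j\<bar>))"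
    using assms by (intro sum_mono loss_diff_le xis_space) auto
  finally show ?thesis by simp
qed

lemma risk_mix_le:
  assumes "l \<in> flat_simplex M" "m \<in> flat_simplex M" "0 \<le> t" "t \<le> 1"
  shows "risk (\<lambda>j. (1 - t) * l j + t * m j) \<le> (1 - t) * risk l + t * risk m"
proof -
  have cvx: "convex_on {-1..1} \<phi>" using surrogate by (simp add: convex_surrogate_def)
  have "risk (\<lambda>j. (1 - t) * l j + t * m j)
      \<le> (\<integral>\<omega>. (1 - t) * \<phi> (aggregate M g l (\<xi> \<omega>)) + t * \<phi> (aggregate M g m (\<xi> \<omega>)) \<partial>P)"
    unfolding risk_def
  proof (intro integral_mono)
    fix \<omega> assume "\<omega> \<in> space P"
    then show "\<phi> (aggregate M g (\<lambda>j. (1 - t) * l j + t * m j) (\<xi> \<omega>))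
        \<le> (1 - t) * \<phi> (aggregate M g l (\<xi> \<omega>)) + t * \<phi> (aggregate M g m (\<xi> \<omega>))"
      using convex_onD[OF cvx, of t "aggregate M g l (\<xi> \<omega>)" "aggregate M g m (\<xi> \<omega>)"]
        assms aggregate_range xi_space by (simp add: aggregate_mix)
  qed (use assms integrable_loss flat_simplex_mix in auto)
  also have "\<dots> = (1 - t) * risk l + t * risk m"
    using assms integrable_loss by (simp add: risk_def)
  finally show ?thesis .
qed

text \<open>By monotonicity and \<open>\<phi> 0 = 1\<close>, the loss is at least 1 wherever the
  aggregate is positive, and it is nonnegative elsewhere. Hence the risk bounds the probability of
  violation.\<close>

lemma chance_feasible_if_risk_le:
  assumes "l \<in> flat_simplex M" "risk l \<le> \<alpha>"
  shows "l \<in> chance_feasible \<alpha> M g P \<xi>"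
proof -
  let ?N = "{\<omega> \<in> space P. aggregate M g l (\<xi> \<omega>) \<le> 0}"
  have N: "?N \<in> events"
    using measurable_compose[OF xi_measurable aggregate_measurable] by measurable
  have "prob (space P - ?N) = (\<integral>\<omega>. indicator (space P - ?N) \<omega> \<partial>P)"
    using N by simp
  also have "\<dots> \<le> risk l"
    unfolding risk_def
  proof (intro integral_mono integrable_loss assms(1))
    show "integrable P (indicator (space P - ?N) :: _ \<Rightarrow> real)"
      using N by (intro integrable_real_indicator) (auto simp: emeasure_eq_measure)
    fix \<omega> assume \<omega>: "\<omega> \<in> space P"
    have range: "aggregate M g l (\<xi> \<omega>) \<in> {-1..1}"
      using assms(1) \<omega> by (intro aggregate_range xi_space)
    show "(indicator (space P - ?N) \<omega> :: real) \<le> \<phi> (aggregate M g l (\<xi> \<omega>))"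
      using phi_nonneg[OF range] phi_mono[OF _ range, of 0] phi_zero \<omega>
      by (auto simp: indicator_def)
  qed
  finally show ?thesis
    using assms prob_compl[OF N] by (simp add: chance_feasible_def)
qed

section \<open>Uniform deviation for the observed sample\<close>

text \<open>Independence makes the joint law a product, and equality of the marginal laws makes its
  factors equal. Bounds on the product space thus become bounds on \<open>P\<close>.\<close>

lemma sample_distr:
  "distr P (Pi\<^sub>M {..<n} (\<lambda>_. X)) (\<lambda>\<omega>. \<lambda>i\<in>{..<n}. \<xi>s i \<omega>) = Pi\<^sub>M {..<n} (\<lambda>_. distr P X \<xi>)"
proof -
  have "distr P (Pi\<^sub>M {..<n} (\<lambda>_. X)) (\<lambda>\<omega>. \<lambda>i\<in>{..<n}. \<xi>s i \<omega>) = Pi\<^sub>M {..<n} (\<lambda>i. distr P X (\<xi>s i))"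
  proof (rule iffD1[OF indep_vars_iff_distr_eq_PiM' copies_indep])
    show "{..<n} \<noteq> {}" using n_pos by (auto simp: lessThan_empty_iff)
  qed (simp add: xis_measurable)
  also have "\<dots> = Pi\<^sub>M {..<n} (\<lambda>_. distr P X \<xi>)"
    by (intro PiM_cong) (auto simp: copies_distr)
  finally show ?thesis .
qed

lemma deviation_tail:
  assumes "finite T" "T \<noteq> {}" "T \<subseteq> flat_simplex M"
  shows "{\<omega> \<in> space P. \<exists>l\<in>T. t \<le> s * (real n * risk l - empirical_risk l \<omega>)} \<in> events"
    and "prob {\<omega> \<in> space P. \<exists>l\<in>T. t \<le> s * (real n * risk l - empirical_risk l \<omega>)}
      \<le> real M * exp (real n * (2 * s * L)\<^sup>2 / 2 - t)"
proof -
  define D where "D = distr P X \<xi>"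
  have D: "space D = space X" "sets D = sets X" by (simp_all add: D_def)
  have meas_D: "borel_measurable D = borel_measurable X" by (intro measurable_cong_sets D refl)
  \<comment> \<open>Subtracting \<open>\<phi> 0 = 1\<close> makes the loss vanish at aggregate 0, so
    the Lipschitz bound against 0 gives \<open>loss_abs\<close>. The constant cancels in expectation
    minus loss.\<close>
  define \<psi> where "\<psi> l x = \<phi> (aggregate M g l x) - 1" for l x
  interpret D: prob_space D
    unfolding D_def by (intro prob_space_distr xi_measurable)
  interpret D: lipschitz_losses D T M g \<psi> L
  proof
    fix l x assume l: "l \<in> T" and x: "x \<in> space D"
    have range: "aggregate M g l x \<in> {-1..1}"
      using l x assms(3) by (intro aggregate_range) (auto simp: D)
    show "\<bar>\<psi> l x\<bar> \<le> L * \<bar>aggregate M g l x\<bar>"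
      using phi_lipschitz[OF range, of 0] by (simp add: \<psi>_def phi_zero)
    fix m assume "m \<in> T"
    then show "\<bar>\<psi> l x - \<psi> m x\<bar> \<le> L * \<bar>aggregate M g l x - aggregate M g m x\<bar>"
      using phi_lipschitz[OF range aggregate_range, of m x] x assms(3) by (auto simp: \<psi>_def D)
  next
    fix l assume "l \<in> T"
    then show "\<psi> l \<in> borel_measurable D"
      unfolding \<psi>_def meas_D using assms(3) by (intro borel_measurable_diff loss_measurable) auto
  qed (use assms L_pos g_abs_le g_measurable in \<open>auto simp: D meas_D\<close>)
  let ?Z = "\<lambda>\<omega>. \<lambda>i\<in>{..<n}. \<xi>s i \<omega>"
  let ?Q = "Pi\<^sub>M {..<n} (\<lambda>_. D)"
  let ?B = "{x \<in> space ?Q. \<exists>l\<in>T. t \<le> s * (\<Sum>i<n. D.expectation (\<psi> l) - \<psi> l (x i))}"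
  have sets_Q: "sets ?Q = sets (Pi\<^sub>M {..<n} (\<lambda>_. X))"
    by (intro sets_PiM_cong D refl)
  have space_Q: "space ?Q = space (Pi\<^sub>M {..<n} (\<lambda>_. X))"
    using sets_Q by (rule sets_eq_imp_space_eq)
  have Z: "?Z \<in> measurable P (Pi\<^sub>M {..<n} (\<lambda>_. X))"
    by (intro measurable_restrict xis_measurable) simp
  have B: "?B \<in> sets ?Q"
  proof -
    have [measurable]: "(\<lambda>x. s * (\<Sum>i<n. D.expectation (\<psi> l) - \<psi> l (x i))) \<in> borel_measurable ?Q"
      if "l \<in> T" for l
      using that by (intro borel_measurable_times borel_measurable_sum borel_measurable_diff
          borel_measurable_const D.measurable_coordinate D.loss_meas) auto
    show ?thesis using assms(1) by measurable
  qed
  have expect: "D.expectation (\<psi> l) = risk l - 1" if "l \<in> T" for l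
  proof -
    have l: "l \<in> flat_simplex M" using that assms(3) by blast
    have "D.expectation (\<psi> l) = expectation (\<lambda>\<omega>. \<phi> (aggregate M g l (\<xi> \<omega>)) - 1)"
      unfolding D_def \<psi>_def
      by (intro integral_distr xi_measurable borel_measurable_diff loss_measurable l) auto
    then show ?thesis using integrable_loss[OF l] by (simp add: risk_def prob_space)
  qed
  have "(\<Sum>i<n. D.expectation (\<psi> l) - \<psi> l (?Z \<omega> i)) = real n * risk l - empirical_risk l \<omega>"
    if "l \<in> T" for l \<omega>
    using that by (simp add: expect \<psi>_def sum_subtractf empirical_risk_def)
  then have preimage: "?Z -` ?B \<inter> space P
      = {\<omega> \<in> space P. \<exists>l\<in>T. t \<le> s * (real n * risk l - empirical_risk l \<omega>)}"
    using measurable_space[OF Z] unfolding space_Q by auto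
  show "{\<omega> \<in> space P. \<exists>l\<in>T. t \<le> s * (real n * risk l - empirical_risk l \<omega>)} \<in> events"
    unfolding preimage[symmetric] using B sets_Q by (intro measurable_sets[OF Z]) simp
  have "emeasure P (?Z -` ?B \<inter> space P) = emeasure ?Q ?B"
    unfolding D_def sample_distr[symmetric]
    using B sets_Q by (intro emeasure_distr[symmetric] Z) (simp add: D_def sample_distr)
  also have "\<dots> \<le> ennreal (real M * exp (real n * (2 * s * L)\<^sup>2 / 2 - t))"
    by (rule D.uniform_deviation_tail)
  finally show "prob {\<omega> \<in> space P. \<exists>l\<in>T. t \<le> s * (real n * risk l - empirical_risk l \<omega>)}
      \<le> real M * exp (real n * (2 * s * L)\<^sup>2 / 2 - t)"
    unfolding preimage by (simp add: emeasure_eq_measure)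
qed

text \<open>The event is fixed before any \<open>l\<close>, so the bound may be applied to a
  solution that depends on the sample in an arbitrary way.\<close>

lemma uniform_deviation:
  assumes "0 < \<delta>" "\<delta> < 1"
  obtains A where "A \<in> events" "1 - \<delta> \<le> prob A"
    "\<And>\<omega>. \<omega> \<in> A \<Longrightarrow> \<forall>l\<in>flat_simplex M.
      \<bar>real n * risk l - empirical_risk l \<omega>\<bar> \<le> kappa L M \<delta> * sqrt (real n)"
proof -
  define q where "q = ln (2 * real M / \<delta>)"
  define r where "r = kappa L M \<delta> * sqrt (real n)"
  \<comment> \<open>This \<open>s\<close> minimises the exponent
    \<open>n * (2 * s * L)\<^sup>2 / 2 - s * (r / 2)\<close> of the tail at level
    \<open>r / 2\<close>. The two terms become \<open>q\<close> and \<open>2 * q\<close>, and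
    \<open>M * exp (- q)\<close> is half of \<open>\<delta>\<close>.\<close>
  define s where "s = sqrt q / (sqrt 2 * L * sqrt (real n))"
  have M: "1 \<le> real M" and n: "1 \<le> real n" using M_pos n_pos by auto
  have "1 < 2 * real M / \<delta>" using assms M by (simp add: field_simps)
  then have q: "0 < q" by (simp add: q_def)
  have s: "0 < s" using q L_pos n by (simp add: s_def)
  have r: "0 < r" using kappa_pos[OF L_pos M_pos assms] n by (simp add: r_def)
  have kappa_q: "kappa L M \<delta> = 4 * sqrt 2 * L * sqrt q"
    by (simp add: kappa_def q_def)
  have sr: "s * (r / 2) = 2 * q"
    using L_pos n q by (simp add: s_def r_def kappa_q field_simps)
  have exponent: "real n * (2 * s * L)\<^sup>2 / 2 = q"
    using L_pos n q by (simp add: s_def power_mult_distrib power_divide field_simps)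
  have tail: "real M * exp (real n * (2 * s * L)\<^sup>2 / 2 - 2 * q) = \<delta> / 2"
  proof -
    have "exp (q - 2 * q) = inverse (exp q)" by (simp add: exp_minus)
    also have "\<dots> = \<delta> / (2 * real M)" using assms M by (simp add: q_def)
    finally show ?thesis using M unfolding exponent by simp
  qed
  \<comment> \<open>With this mesh, passing to a net point changes \<open>n * risk\<close> and the
    empirical risk by at most \<open>r / 4\<close> each, together the remaining half of
    \<open>r\<close>.\<close>
  have \<eta>: "0 < r / (4 * real n * L)" using r n L_pos by simp
  obtain T where T: "finite T" "T \<subseteq> flat_simplex M"
    "\<And>l. l \<in> flat_simplex M \<Longrightarrow> \<exists>m\<in>T. (\<Sum>j<M. \<bar>l j - m j\<bar>) \<le> r / (4 * real n * L)"
    using flat_simplex_net[OF \<eta>] by metis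
  have "T \<noteq> {}" using T(3) flat_simplex_nonempty[OF M_pos] by blast
  note tail_bound = deviation_tail[OF T(1) \<open>T \<noteq> {}\<close> T(2), of "2 * q"]
  let ?U = "{\<omega> \<in> space P. \<exists>l\<in>T. 2 * q \<le> s * (real n * risk l - empirical_risk l \<omega>)}"
  let ?V = "{\<omega> \<in> space P. \<exists>l\<in>T. 2 * q \<le> - s * (real n * risk l - empirical_risk l \<omega>)}"
  have UV: "?U \<in> events" "?V \<in> events" by (rule tail_bound)+
  \<comment> \<open>One tail uses \<open>s\<close>, the other \<open>- s\<close>; the exponent
    contains only the square of \<open>s\<close>, so each costs \<open>\<delta> / 2\<close>.\<close>
  have "prob (?U \<union> ?V) \<le> prob ?U + prob ?V" using UV by (rule measure_Un_le)
  also have "\<dots> \<le> \<delta> / 2 + \<delta> / 2"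
    using tail_bound(2)[of s] tail_bound(2)[of "- s"] unfolding tail[symmetric] by (intro add_mono) simp_all
  finally have UV_prob: "prob (?U \<union> ?V) \<le> \<delta>" by simp
  show thesis
  proof (rule that[of "space P - (?U \<union> ?V)"])
    show "space P - (?U \<union> ?V) \<in> events" using UV by auto
    show "1 - \<delta> \<le> prob (space P - (?U \<union> ?V))"
      using prob_compl[of "?U \<union> ?V"] UV UV_prob by auto
    fix \<omega> assume \<omega>: "\<omega> \<in> space P - (?U \<union> ?V)"
    show "\<forall>l\<in>flat_simplex M. \<bar>real n * risk l - empirical_risk l \<omega>\<bar> \<le> kappa L M \<delta> * sqrt (real n)"
    proof
      fix l assume l: "l \<in> flat_simplex M"
      obtain m where m: "m \<in> T" "(\<Sum>j<M. \<bar>l j - m j\<bar>) \<le> r / (4 * real n * L)" using T(3)[OF l] by blast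
      then have m': "m \<in> flat_simplex M" using T(2) by blast
      have "\<not> 2 * q \<le> s * (real n * risk m - empirical_risk m \<omega>)"
        "\<not> 2 * q \<le> - s * (real n * risk m - empirical_risk m \<omega>)"
        using \<omega> m(1) by blast+
      then have "s * (real n * risk m - empirical_risk m \<omega>) < s * (r / 2)"
        "s * - (real n * risk m - empirical_risk m \<omega>) < s * (r / 2)"
        unfolding sr by (simp_all only: not_le minus_mult_commute)
      then have net: "\<bar>real n * risk m - empirical_risk m \<omega>\<bar> < r / 2"
        using s unfolding mult_less_cancel_left_pos[OF s] by linarith
      have "L * (\<Sum>j<M. \<bar>l j - m j\<bar>) \<le> L * (r / (4 * real n * L))"
        using m(2) L_pos by (intro mult_left_mono) auto
      also have "\<dots> = r / (4 * real n)" using L_pos by simp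
      finally have approx: "L * (\<Sum>j<M. \<bar>l j - m j\<bar>) \<le> r / (4 * real n)" .
      have "real n * \<bar>risk l - risk m\<bar> \<le> real n * (r / (4 * real n))"
        using risk_diff_le[OF l m'] approx by (intro mult_left_mono) auto
      moreover have "\<bar>empirical_risk l \<omega> - empirical_risk m \<omega>\<bar> \<le> real n * (r / (4 * real n))"
        using empirical_risk_diff_le[OF l m', of \<omega>] \<omega> mult_left_mono[OF approx, of "real n"] by auto
      moreover have "real n * (r / (4 * real n)) = r / 4" using n by simp
      moreover have "real n * \<bar>risk l - risk m\<bar> = \<bar>real n * risk l - real n * risk m\<bar>"
        by (simp add: abs_mult flip: right_diff_distrib)
      ultimately show "\<bar>real n * risk l - empirical_risk l \<omega>\<bar> \<le> kappa L M \<delta> * sqrt (real n)"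
        using net unfolding r_def[symmetric] by linarith
    qed
  qed
qed

subsection \<open>Suboptimality of the sample solution\<close>

lemma surrogate_feasible_eq: "surrogate_feasible \<phi> \<alpha> M g P \<xi> = {l \<in> flat_simplex M. risk l \<le> \<alpha>}"
  by (simp add: surrogate_feasible_def risk_def)

text \<open>From here the argument is deterministic: one outcome \<open>\<omega>\<close> satisfying
  the uniform deviation bound is fixed.\<close>

context
  fixes f :: "(nat \<Rightarrow> real) \<Rightarrow> real" and \<alpha> \<kappa> :: real and \<omega> :: 'a and lt :: "nat \<Rightarrow> real"
  assumes \<alpha>: "0 < \<alpha>" and \<kappa>: "0 < \<kappa>"
    and dev: "\<forall>l\<in>flat_simplex M. \<bar>real n * risk l - empirical_risk l \<omega>\<bar> \<le> \<kappa> * sqrt (real n)"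
    and sol: "sample_solution f \<phi> \<alpha> \<kappa> M g n (\<lambda>i. \<xi>s i \<omega>) lt"
begin

lemma
  shows solution_simplex: "lt \<in> flat_simplex M"
    and solution_constraint: "empirical_risk lt \<omega> \<le> real n * \<alpha> - \<kappa> * sqrt (real n)"
    and solution_min: "l \<in> flat_simplex M \<Longrightarrow> empirical_risk l \<omega> \<le> real n * \<alpha> - \<kappa> * sqrt (real n) \<Longrightarrow> f lt \<le> f l"
  using sol by (auto simp: sample_solution_def is_arg_min_def empirical_risk_def not_less)

text \<open>The margin \<open>\<kappa> * sqrt n\<close> in the sample constraint is exactly what
  absorbs the deviation.\<close>

lemma solution_risk_le: "risk lt \<le> \<alpha>"
proof -
  have "real n * risk lt \<le> real n * \<alpha>"
    using bspec[OF dev solution_simplex] solution_constraint by linarith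
  then show ?thesis using n_pos by simp
qed

text \<open>The gap is nonnegative because the solution itself competes in the true problem; this
  half serves the absolute value in the asymptotic rate.\<close>

lemma solution_gap:
  assumes cvx: "convex_on_simplex M f" and osc: "oscillation_le M f B"
    and \<epsilon>: "0 < \<epsilon>" "\<epsilon> < 1" and feasible: "surrogate_feasible \<phi> (\<epsilon> * \<alpha>) M g P \<xi> \<noteq> {}"
  shows "0 \<le> f lt - surrogate_value f \<phi> \<alpha> M g P \<xi>"
    and "f lt - surrogate_value f \<phi> \<alpha> M g P \<xi> \<le> B * (2 * \<kappa> / ((1 - \<epsilon>) * \<alpha> * sqrt (real n)))"
proof -
  \<comment> \<open>Moving a competitor by the fraction \<open>t\<close> towards \<open>e\<close>
    lowers the bound on its risk by \<open>t * (1 - \<epsilon>) * \<alpha>\<close>. Summed over the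
    sample this must be \<open>2 * \<kappa> * sqrt n\<close>: once for the margin of the constraint
    and once for the deviation.\<close>
  define t where "t = 2 * \<kappa> / ((1 - \<epsilon>) * \<alpha> * sqrt (real n))"
  have n: "0 < real n" using n_pos by simp
  have t: "0 < t" using \<alpha> \<kappa> \<epsilon> n by (simp add: t_def)
  have B: "0 \<le> B" using osc solution_simplex by (force simp: oscillation_le_def)
  obtain e where e: "e \<in> flat_simplex M" "risk e \<le> \<epsilon> * \<alpha>"
    using feasible by (auto simp: surrogate_feasible_eq)
  have gap: "f lt \<le> f l + B * t" if l: "l \<in> flat_simplex M" "risk l \<le> \<alpha>" for l
  proof (cases "t \<le> 1")
    case True
    let ?m = "\<lambda>j. (1 - t) * l j + t * e j"
    have m: "?m \<in> flat_simplex M" using l e t True by (intro flat_simplex_mix) auto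
    have "risk ?m \<le> (1 - t) * risk l + t * risk e" using l e t True by (intro risk_mix_le) auto
    also have "\<dots> \<le> (1 - t) * \<alpha> + t * (\<epsilon> * \<alpha>)" using l e t True by (intro add_mono mult_left_mono) auto
    also have "\<dots> = \<alpha> - t * ((1 - \<epsilon>) * \<alpha>)" by (simp add: algebra_simps)
    also have "t * ((1 - \<epsilon>) * \<alpha>) = 2 * \<kappa> / sqrt (real n)" using \<alpha> \<epsilon> by (simp add: t_def)
    finally have "real n * risk ?m \<le> real n * (\<alpha> - 2 * \<kappa> / sqrt (real n))" by (intro mult_left_mono) auto
    also have "\<dots> = real n * \<alpha> - 2 * \<kappa> * sqrt (real n)"
      using n by (simp add: right_diff_distrib field_simps)
    finally have "empirical_risk ?m \<omega> \<le> real n * \<alpha> - \<kappa> * sqrt (real n)"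
      using bspec[OF dev m] by linarith
    then have "f lt \<le> f ?m" by (rule solution_min[OF m])
    also have "\<dots> \<le> (1 - t) * f l + t * f e"
      using cvx l e t True by (auto simp: convex_on_simplex_def)
    also have "\<dots> = f l + t * (f e - f l)" by (simp add: algebra_simps)
    also have "\<dots> \<le> f l + t * B"
      using osc l e t by (intro add_left_mono mult_left_mono) (auto simp: oscillation_le_def)
    finally show ?thesis by (simp add: mult.commute)
  next
    case False
    \<comment> \<open>For \<open>t > 1\<close> mixing is impossible, but the claimed bound then
      exceeds the oscillation.\<close>
    have "f lt - f l \<le> B" using osc solution_simplex l by (auto simp: oscillation_le_def)
    also have "\<dots> \<le> B * t" using False mult_left_mono[of 1 t B] B by simp
    finally show ?thesis by simp
  qed
  have ne: "surrogate_feasible \<phi> \<alpha> M g P \<xi> \<noteq> {}"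
    using solution_simplex solution_risk_le by (auto simp: surrogate_feasible_eq)
  have "f lt - B * t \<le> surrogate_value f \<phi> \<alpha> M g P \<xi>"
    unfolding surrogate_value_def using gap by (intro cINF_greatest ne) (force simp: surrogate_feasible_eq)
  then show "f lt - surrogate_value f \<phi> \<alpha> M g P \<xi> \<le> B * (2 * \<kappa> / ((1 - \<epsilon>) * \<alpha> * sqrt (real n)))"
    by (simp add: t_def)
  have "surrogate_value f \<phi> \<alpha> M g P \<xi> \<le> f lt"
    unfolding surrogate_value_def
  proof (rule cINF_lower)
    \<comment> \<open>The infimum of reals needs a lower bound on the objective; the inequality
      \<open>gap\<close> provides \<open>f lt - B * t\<close>.\<close>
    show "bdd_below (f ` surrogate_feasible \<phi> \<alpha> M g P \<xi>)"
      using gap by (intro bdd_belowI2[of _ "f lt - B * t"]) (force simp: surrogate_feasible_eq)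
    show "lt \<in> surrogate_feasible \<phi> \<alpha> M g P \<xi>"
      using solution_simplex solution_risk_le by (simp add: surrogate_feasible_eq)
  qed
  then show "0 \<le> f lt - surrogate_value f \<phi> \<alpha> M g P \<xi>" by simp
qed

end

end

section \<open>Growth of \<open>kappa\<close> in \<open>M\<close>, and assembly of the
  theorem\<close>

text \<open>For \<open>M \<ge> 2 / \<delta>\<close> the argument of the logarithm is at most the
  square of \<open>M\<close>. The resulting factor \<open>sqrt 2\<close> turns
  \<open>4 * sqrt 2\<close> into 8.\<close>

lemma kappa_le_sqrt_ln:
  assumes "0 < L" "0 < \<delta>" "2 / \<delta> \<le> real M" "1 \<le> M"
  shows "kappa L M \<delta> \<le> 8 * L * sqrt (ln (real M))"
proof -
  have "2 * real M / \<delta> = 2 / \<delta> * real M" by simp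
  also have "\<dots> \<le> real M * real M" using assms(3) by (rule mult_right_mono) simp
  finally have "ln (2 * real M / \<delta>) \<le> ln (real M * real M)"
    using assms by (subst ln_le_cancel_iff) auto
  also have "\<dots> = 2 * ln (real M)" using assms by (simp add: ln_mult)
  finally have "sqrt (ln (2 * real M / \<delta>)) \<le> sqrt 2 * sqrt (ln (real M))"
    by (simp flip: real_sqrt_mult)
  then have "kappa L M \<delta> \<le> 4 * sqrt 2 * L * (sqrt 2 * sqrt (ln (real M)))"
    unfolding kappa_def using assms by (intro mult_left_mono) auto
  also have "\<dots> = 4 * (sqrt 2 * sqrt 2) * L * sqrt (ln (real M))" by (simp only: mult_ac)
  finally show ?thesis by (simp add: kappa_def)
qed

theorem theorem5p1:
  fixes \<delta> \<alpha> L :: real and \<phi> :: "real \<Rightarrow> real"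
  assumes "0 < \<delta>" "\<delta> < 1/2" and "0 < \<alpha>" "\<alpha> < 1/2" and "0 < L"
    and "convex_surrogate \<phi>" and "L-lipschitz_on {-1..1} \<phi>"
  shows "\<exists>(C :: real \<Rightarrow> real \<Rightarrow> real) (N :: real \<Rightarrow> real \<Rightarrow> nat). (\<forall>\<epsilon> B. 0 < C \<epsilon> B) \<and>
    (\<forall>(P :: 'a measure) (X :: 'x measure) \<xi> \<xi>s g M n f.
      chance_sample P X \<xi> \<xi>s g M n \<longrightarrow> convex_on_simplex M f \<longrightarrow>
      (\<exists>A\<in>sets P. measure P A \<ge> 1 - 2 * \<delta> \<and>
        (\<forall>\<omega>\<in>A. \<forall>lt. sample_solution f \<phi> \<alpha> (kappa L M \<delta>) M g n (\<lambda>i. \<xi>s i \<omega>) lt \<longrightarrow>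
          lt \<in> chance_feasible \<alpha> M g P \<xi> \<and>
          (\<forall>\<epsilon>. 0 < \<epsilon> \<and> \<epsilon> < 1 \<and> surrogate_feasible \<phi> (\<epsilon> * \<alpha>) M g P \<xi> \<noteq> {} \<longrightarrow>
            (oscillation_le M f (2 * \<phi> 1) \<and>
               real n \<ge> (4 * kappa L M \<delta> / ((1 - \<epsilon>) * \<alpha>))\<^sup>2 \<longrightarrow>
               f lt - surrogate_value f \<phi> \<alpha> M g P \<xi>
                 \<le> 4 * \<phi> 1 * kappa L M \<delta> / ((1 - \<epsilon>) * \<alpha> * sqrt (real n))) \<and>
            (\<forall>B. oscillation_le M f B \<and> M \<ge> N \<epsilon> B \<and> n \<ge> N \<epsilon> B \<longrightarrow>
               \<bar>f lt - surrogate_value f \<phi> \<alpha> M g P \<xi>\<bar>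
                 \<le> C \<epsilon> B * sqrt (ln (real M) / real n))))))"
proof -
  \<comment> \<open>The gap bound
    \<open>2 * B * \<kappa> / ((1 - \<epsilon>) * \<alpha> * sqrt n)\<close> with
    \<open>\<kappa> \<le> 8 * L * sqrt (ln M)\<close> gives the constant 16; the absolute value and
    the summand 1 keep \<open>C\<close> positive for all arguments. The threshold \<open>N\<close>
    below ensures \<open>M \<ge> 2 / \<delta>\<close>.\<close>
  define C where "C \<epsilon> B = 1 + \<bar>16 * B * L / ((1 - \<epsilon>) * \<alpha>)\<bar>" for \<epsilon> B :: real
  define N where "N \<epsilon> B = nat \<lceil>2 / \<delta>\<rceil>" for \<epsilon> B :: real
  show ?thesis
  proof (rule exI[of _ C], rule exI[of _ N], intro conjI allI impI)
    show "0 < C \<epsilon> B" for \<epsilon> B by (simp add: C_def add_pos_nonneg)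
    fix P :: "'a measure" and X :: "'x measure" and \<xi> \<xi>s g M n f
    assume sample: "chance_sample P X \<xi> \<xi>s g M n" and cvx: "convex_on_simplex M f"
    interpret chance_sample P X \<xi> \<xi>s g M n by (rule sample)
    interpret chance_surrogate P X \<xi> \<xi>s g M n \<phi> L by unfold_locales (use assms in auto)
    define \<kappa> where "\<kappa> = kappa L M \<delta>"
    have \<kappa>: "0 < \<kappa>" unfolding \<kappa>_def using assms M_pos by (intro kappa_pos) auto
    have \<delta>: "0 < \<delta>" "\<delta> < 1" using assms by auto
    obtain A where A: "A \<in> events" "1 - \<delta> \<le> prob A"
      "\<And>\<omega>. \<omega> \<in> A \<Longrightarrow> \<forall>l\<in>flat_simplex M.
        \<bar>real n * risk l - empirical_risk l \<omega>\<bar> \<le> \<kappa> * sqrt (real n)"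
      unfolding \<kappa>_def by (rule uniform_deviation[OF \<delta>]) blast
    show "\<exists>A\<in>sets P. measure P A \<ge> 1 - 2 * \<delta> \<and>
        (\<forall>\<omega>\<in>A. \<forall>lt. sample_solution f \<phi> \<alpha> (kappa L M \<delta>) M g n (\<lambda>i. \<xi>s i \<omega>) lt \<longrightarrow>
          lt \<in> chance_feasible \<alpha> M g P \<xi> \<and>
          (\<forall>\<epsilon>. 0 < \<epsilon> \<and> \<epsilon> < 1 \<and> surrogate_feasible \<phi> (\<epsilon> * \<alpha>) M g P \<xi> \<noteq> {} \<longrightarrow>
            (oscillation_le M f (2 * \<phi> 1) \<and>
               real n \<ge> (4 * kappa L M \<delta> / ((1 - \<epsilon>) * \<alpha>))\<^sup>2 \<longrightarrow>
               f lt - surrogate_value f \<phi> \<alpha> M g P \<xi>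
                 \<le> 4 * \<phi> 1 * kappa L M \<delta> / ((1 - \<epsilon>) * \<alpha> * sqrt (real n))) \<and>
            (\<forall>B. oscillation_le M f B \<and> M \<ge> N \<epsilon> B \<and> n \<ge> N \<epsilon> B \<longrightarrow>
               \<bar>f lt - surrogate_value f \<phi> \<alpha> M g P \<xi>\<bar>
                 \<le> C \<epsilon> B * sqrt (ln (real M) / real n))))"
      unfolding \<kappa>_def[symmetric]
    proof (rule bexI[OF _ A(1)], intro conjI ballI allI impI; (elim conjE)?)
      show "1 - 2 * \<delta> \<le> prob A" using A(2) \<delta> by simp
      fix \<omega> lt
      assume \<omega>: "\<omega> \<in> A" and sol: "sample_solution f \<phi> \<alpha> \<kappa> M g n (\<lambda>i. \<xi>s i \<omega>) lt"
      note solution_facts = assms(3) \<kappa> A(3)[OF \<omega>] sol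
      show "lt \<in> chance_feasible \<alpha> M g P \<xi>"
        using solution_simplex[OF solution_facts] solution_risk_le[OF solution_facts]
        by (rule chance_feasible_if_risk_le)
      fix \<epsilon> :: real
      assume \<epsilon>: "0 < \<epsilon>" "\<epsilon> < 1" "surrogate_feasible \<phi> (\<epsilon> * \<alpha>) M g P \<xi> \<noteq> {}"
      note gap = solution_gap[OF solution_facts cvx]
      \<comment> \<open>For \<open>B = 2 * \<phi> 1\<close> the factor \<open>2 * B\<close> of the
        gap bound is the stated \<open>4 * \<phi> 1\<close>.\<close>
      show "f lt - surrogate_value f \<phi> \<alpha> M g P \<xi> \<le> 4 * \<phi> 1 * \<kappa> / ((1 - \<epsilon>) * \<alpha> * sqrt (real n))"
        if "oscillation_le M f (2 * \<phi> 1)"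
        using gap(2)[OF that \<epsilon>] by simp
      fix B assume B: "oscillation_le M f B" and large: "N \<epsilon> B \<le> M"
      let ?G = "f lt - surrogate_value f \<phi> \<alpha> M g P \<xi>"
      have "0 \<le> B" using B solution_simplex[OF solution_facts] by (force simp: oscillation_le_def)
      have "2 / \<delta> \<le> real M" using large by (simp add: N_def)
      then have "\<kappa> \<le> 8 * L * sqrt (ln (real M))"
        unfolding \<kappa>_def using assms M_pos by (intro kappa_le_sqrt_ln) auto
      then have "?G \<le> B * (2 * (8 * L * sqrt (ln (real M))) / ((1 - \<epsilon>) * \<alpha> * sqrt (real n)))"
        using \<open>0 \<le> B\<close> assms(3) \<epsilon>
        by (intro order_trans[OF gap(2)[OF B \<epsilon>]] mult_left_mono divide_right_mono) auto
      also have "\<dots> = 16 * B * L / ((1 - \<epsilon>) * \<alpha>) * sqrt (ln (real M) / real n)"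
        by (simp add: real_sqrt_divide)
      also have "\<dots> \<le> C \<epsilon> B * sqrt (ln (real M) / real n)"
        using M_pos abs_ge_self[of "16 * B * L / ((1 - \<epsilon>) * \<alpha>)"] unfolding C_def
        by (intro mult_right_mono) (linarith | simp)+
      finally show "\<bar>?G\<bar> \<le> C \<epsilon> B * sqrt (ln (real M) / real n)"
        using gap(1)[OF B \<epsilon>] by simp
    qed
  qed
qed

end
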